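(* There is no isomorphism between the diagrams $\ker f$ and $\ker g$ in $\mathcal{D}_T(\mathbf{Ab})$, where $T=\{0,1,2\}$ with $0<1<2$, and $f,g$ are the maps, defined in the context, from the diagram $A_0\subset A_1\subset A_2$ to the constant diagram $\mathbf{Z}$.
   Context: $\mathcal{D}_T(\mathbf{Ab})$ is the category of diagrams of abelian groups based on the linearly ordered set $T=\{0,1,2\}$: an object is a functor from $T$ (viewed as a category, with one arrow $i\to j$ whenever $i\le j$) to the category of abelian groups, and morphisms are natural transformations. The constant diagram $\mathbf{Z}$ has the additive group of integers at every node and identity maps between nodes. Let $A_0\subset A_1\subset A_2=\mathbf{Z}^3$ be the subgroups of $\mathbf{Z}^3$ defined as follows: $A_0$ is generated by $(1,3,0)$ and $(3,1,0)$; $A_1$ is generated by $(1,0,-24)$, $(0,1,8)$ and $(0,0,64)$; $A_2=\mathbf{Z}^3$. These form an object of $\mathcal{D}_T(\mathbf{Ab})$ with group $A_i$ at node $i$ and inclusions as maps. Define $f,g:\mathbf{Z}^3\to\mathbf{Z}$ by $f(a,b,c)=a$ and $g(a,b,c)=b$. Restricting $f$ and $g$ to each $A_i$ gives two morphisms, also denoted $f$ and $g$, from this diagram to the constant diagram $\mathbf{Z}$. Their kernels are the diagrams $\ker f$, with group $\ker_i f=A_i\cap\{(a,b,c):a=0\}$ at node $i$, and $\ker g$, with group $\ker_i g=A_i\cap\{(a,b,c):b=0\}$ at node $i$, with inclusions as maps. *)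

theory Defs
  imports "HOL-Algebra.Algebra"
begin

section \<open>Diagrams of abelian groups based on a linearly ordered set\<close>

text \<open>
  The arrow \<open>i \<rightarrow> j\<close> is meaningful only for \<open>i \<le> j\<close> in the base set \<open>T\<close>; the values of
  \<open>node\<close> and \<open>arrow\<close> elsewhere are junk and are ignored throughout. As usual for carrier-based
  groups, maps are likewise compared on carriers only.
\<close>

record ('i, 'a) diagram =
  node :: "'i \<Rightarrow> 'a monoid"
  arrow :: "'i \<Rightarrow> 'i \<Rightarrow> 'a \<Rightarrow> 'a"

definition is_diagram :: "'i::linorder set \<Rightarrow> ('i, 'a) diagram \<Rightarrow> bool" where
  "is_diagram T D \<longleftrightarrow>
     (\<forall>i\<in>T. comm_group (node D i)) \<and>
     (\<forall>i\<in>T. \<forall>j\<in>T. i \<le> j \<longrightarrow> arrow D i j \<in> hom (node D i) (node D j)) \<and>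
     (\<forall>i\<in>T. \<forall>x\<in>carrier (node D i). arrow D i i x = x) \<and>
     (\<forall>i\<in>T. \<forall>j\<in>T. \<forall>k\<in>T. i \<le> j \<longrightarrow> j \<le> k \<longrightarrow>
        (\<forall>x\<in>carrier (node D i). arrow D j k (arrow D i j x) = arrow D i k x))"

definition is_morphism ::
  "'i::linorder set \<Rightarrow> ('i, 'a) diagram \<Rightarrow> ('i, 'b) diagram \<Rightarrow> ('i \<Rightarrow> 'a \<Rightarrow> 'b) \<Rightarrow> bool" where
  "is_morphism T D E h \<longleftrightarrow>
     (\<forall>i\<in>T. h i \<in> hom (node D i) (node E i)) \<and>
     (\<forall>i\<in>T. \<forall>j\<in>T. i \<le> j \<longrightarrow>
        (\<forall>x\<in>carrier (node D i). h j (arrow D i j x) = arrow E i j (h i x)))"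

definition is_isomorphism ::
  "'i::linorder set \<Rightarrow> ('i, 'a) diagram \<Rightarrow> ('i, 'b) diagram \<Rightarrow> ('i \<Rightarrow> 'a \<Rightarrow> 'b) \<Rightarrow> bool" where
  "is_isomorphism T D E h \<longleftrightarrow>
     is_morphism T D E h \<and>
     (\<exists>k. is_morphism T E D k \<and>
        (\<forall>i\<in>T. \<forall>x\<in>carrier (node D i). k i (h i x) = x) \<and>
        (\<forall>i\<in>T. \<forall>y\<in>carrier (node E i). h i (k i y) = y))"

definition const_diagram :: "'a monoid \<Rightarrow> ('i, 'a) diagram" where
  "const_diagram G = \<lparr>node = (\<lambda>_. G), arrow = (\<lambda>_ _ x. x)\<rparr>"

definition subgroup_diagram :: "'a monoid \<Rightarrow> ('i \<Rightarrow> 'a set) \<Rightarrow> ('i, 'a) diagram" where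
  "subgroup_diagram G A = \<lparr>node = (\<lambda>i. G\<lparr>carrier := A i\<rparr>), arrow = (\<lambda>_ _ x. x)\<rparr>"

definition kernel_diagram ::
  "('i, 'a) diagram \<Rightarrow> ('i, 'b) diagram \<Rightarrow> ('i \<Rightarrow> 'a \<Rightarrow> 'b) \<Rightarrow> ('i, 'a) diagram" where
  "kernel_diagram D E h =
     \<lparr>node = (\<lambda>i. (node D i)\<lparr>carrier := kernel (node D i) (node E i) (h i)\<rparr>), arrow = arrow D\<rparr>"


section \<open>The diagram \<open>A\<^sub>0 \<subseteq> A\<^sub>1 \<subseteq> A\<^sub>2\<close> and the maps \<open>f\<close>, \<open>g\<close>\<close>

definition T :: "nat set" where
  "T = {0, 1, 2}"

definition Z3 :: "(int \<times> int \<times> int) monoid" where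
  "Z3 = integer_group \<times>\<times> (integer_group \<times>\<times> integer_group)"

definition A :: "nat \<Rightarrow> (int \<times> int \<times> int) set" where
  "A i = (if i = 0 then generate Z3 {(1, 3, 0), (3, 1, 0)}
          else if i = 1 then generate Z3 {(1, 0, -24), (0, 1, 8), (0, 0, 64)}
          else carrier Z3)"

definition A_diagram :: "(nat, int \<times> int \<times> int) diagram" where
  "A_diagram = subgroup_diagram Z3 A"

definition Z_diagram :: "(nat, int) diagram" where
  "Z_diagram = const_diagram integer_group"

definition f :: "nat \<Rightarrow> int \<times> int \<times> int \<Rightarrow> int" where
  "f i = (\<lambda>(a, b, c). a)"

definition g :: "nat \<Rightarrow> int \<times> int \<times> int \<Rightarrow> int" where
  "g i = (\<lambda>(a, b, c). b)"

abbreviation ker_f :: "(nat, int \<times> int \<times> int) diagram" where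
  "ker_f \<equiv> kernel_diagram A_diagram Z_diagram f"

abbreviation ker_g :: "(nat, int \<times> int \<times> int) diagram" where
  "ker_g \<equiv> kernel_diagram A_diagram Z_diagram g"


section \<open>Well-formedness of these objects and maps\<close>

lemma subgroup_imp_comm_group:
  assumes "comm_group G" and "subgroup H G"
  shows "comm_group (G\<lparr>carrier := H\<rparr>)"
proof -
  interpret comm_group G by fact
  interpret H: subgroup H G by fact
  show ?thesis
    by (rule group.group_comm_groupI[OF subgroup_imp_group[OF assms(2)]])
      (auto intro: m_comm)
qed

lemma is_diagram_const: "comm_group G \<Longrightarrow> is_diagram S (const_diagram G)"
  by (auto simp: is_diagram_def const_diagram_def hom_def)

lemma is_diagram_subgroup:
  assumes "comm_group G" and "\<And>i. i \<in> S \<Longrightarrow> subgroup (H i) G"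
    and "\<And>i j. i \<in> S \<Longrightarrow> j \<in> S \<Longrightarrow> i \<le> j \<Longrightarrow> H i \<subseteq> H j"
  shows "is_diagram S (subgroup_diagram G H)"
  using assms subgroup_imp_comm_group[of G]
  by (fastforce simp: is_diagram_def subgroup_diagram_def hom_def)

lemma is_diagram_kernel:
  assumes D: "is_diagram S D" and E: "is_diagram S E" and h: "is_morphism S D E h"
  shows "is_diagram S (kernel_diagram D E h)"
proof -
  have ab: "comm_group (node D i)" "comm_group (node E i)" if "i \<in> S" for i
    using D E that by (auto simp: is_diagram_def)
  have hom: "h i \<in> hom (node D i) (node E i)" if "i \<in> S" for i
    using h that by (auto simp: is_morphism_def)
  have homE: "arrow E i j \<in> hom (node E i) (node E j)" if "i \<in> S" "j \<in> S" "i \<le> j" for i j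
    using E that by (auto simp: is_diagram_def)
  have sub: "subgroup (kernel (node D i) (node E i) (h i)) (node D i)" if "i \<in> S" for i
    using ab[OF that] hom[OF that]
    by (intro group_hom.subgroup_kernel) (simp add: group_hom_def group_hom_axioms_def comm_group_def)
  have one: "arrow E i j \<one>\<^bsub>node E i\<^esub> = \<one>\<^bsub>node E j\<^esub>" if "i \<in> S" "j \<in> S" "i \<le> j" for i j
    using hom_one[OF homE[OF that]] ab that by (auto simp: comm_group_def)
  show ?thesis
    using D h subgroup_imp_comm_group[OF ab(1) sub] one
    by (auto simp: is_diagram_def is_morphism_def kernel_diagram_def kernel_def hom_def Pi_def)
qed

lemma carrier_Z3 [simp]: "carrier Z3 = UNIV"
  and mult_Z3 [simp]: "(a, b, c) \<otimes>\<^bsub>Z3\<^esub> (a', b', c') = (a + a', b + b', c + c')"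
  and one_Z3 [simp]: "\<one>\<^bsub>Z3\<^esub> = (0, 0, 0)"
  by (auto simp: Z3_def)

lemma comm_group_Z3: "comm_group Z3"
proof (rule group.group_comm_groupI)
  show "group Z3"
    by (simp add: Z3_def DirProd_group)
qed auto

lemma subgroup_A: "subgroup (A i) Z3"
proof -
  interpret comm_group Z3 by (rule comm_group_Z3)
  show ?thesis
    using subgroup_self by (auto simp: A_def intro: generate_is_subgroup)
qed

lemma A_0_subset_A_1: "A 0 \<subseteq> A 1"
proof -
  interpret comm_group Z3 by (rule comm_group_Z3)
  define B where "B = {(1, 0, -24), (0, 1, 8), (0, 0, 64) :: int \<times> int \<times> int}"
  have add: "(a + a', b + b', c + c') \<in> generate Z3 B"
    if "(a, b, c) \<in> generate Z3 B" "(a', b', c') \<in> generate Z3 B" for a b c a' b' c'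
    using generate.eng[OF that] by simp
  have e: "(1, 0, -24) \<in> generate Z3 B" "(0, 1, 8) \<in> generate Z3 B" "(0, 0, 64) \<in> generate Z3 B"
    by (auto simp: B_def intro: generate.incl)
  have "(1, 3, 0) \<in> generate Z3 B"
    using add[OF e(1) add[OF e(2) add[OF e(2) e(2)]]] by simp
  moreover have "(3, 1, 0) \<in> generate Z3 B"
    using add[OF e(1) add[OF e(1) add[OF e(1) add[OF e(2) e(3)]]]] by simp
  moreover have "subgroup (generate Z3 B) Z3"
    by (rule generate_is_subgroup) simp
  ultimately have "generate Z3 {(1, 3, 0), (3, 1, 0)} \<subseteq> generate Z3 B"
    by (intro generate_subgroup_incl) auto
  then show ?thesis by (simp add: A_def B_def)
qed

lemma is_diagram_A: "is_diagram T A_diagram"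
  unfolding A_diagram_def
proof (rule is_diagram_subgroup[OF comm_group_Z3 subgroup_A])
  fix i j :: nat
  assume "i \<in> T" "j \<in> T" "i \<le> j"
  moreover have "A 2 = UNIV" by (simp add: A_def)
  ultimately show "A i \<subseteq> A j"
    using A_0_subset_A_1 by (auto simp: T_def)
qed

lemma is_diagram_Z: "is_diagram T Z_diagram"
  unfolding Z_diagram_def by (rule is_diagram_const[OF abelian_integer_group])

lemma is_morphism_f: "is_morphism T A_diagram Z_diagram f"
  and is_morphism_g: "is_morphism T A_diagram Z_diagram g"
  by (auto simp: is_morphism_def A_diagram_def subgroup_diagram_def Z_diagram_def
      const_diagram_def f_def g_def hom_def)

lemma is_diagram_ker_f: "is_diagram T ker_f"
  and is_diagram_ker_g: "is_diagram T ker_g"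
  by (rule is_diagram_kernel[OF is_diagram_A is_diagram_Z is_morphism_f])
    (rule is_diagram_kernel[OF is_diagram_A is_diagram_Z is_morphism_g])

lemma carrier_ker_f: "carrier (node ker_f i) = A i \<inter> {(a, b, c). a = 0}"
  and carrier_ker_g: "carrier (node ker_g i) = A i \<inter> {(a, b, c). b = 0}"
  by (auto simp: kernel_diagram_def A_diagram_def subgroup_diagram_def Z_diagram_def
      const_diagram_def kernel_def f_def g_def)

end

theory Submission
  imports Defs
begin

text \<open>
  In the coordinates \<open>(b, c)\<close> on \<open>ker\<^sub>2 f\<close> and \<open>(a, c)\<close> on \<open>ker\<^sub>2 g\<close>, both kernel diagrams become
  chains of lattices in \<open>\<int>\<^sup>2\<close>. At node 0 both are \<open>\<int>(8, 0)\<close>; at node 1 the first is spanned by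
  \<open>(1, 8)\<close> and \<open>(0, 64)\<close>, the second by \<open>(1, -24)\<close> and \<open>(0, 64)\<close>. As all arrows are inclusions, an
  isomorphism of diagrams amounts to one automorphism \<open>H\<close> of \<open>\<int>\<^sup>2\<close> that carries each lattice of the
  first chain onto the corresponding lattice of the second.

  Preserving \<open>\<int>(8, 0)\<close> makes \<open>H\<close> triangular: \<open>H(1, 0) = (e, 0)\<close> and \<open>H(0, 1) = (m, d)\<close>, where
  invertibility forces \<open>e\<close> and \<open>d\<close> to be \<open>1\<close> or \<open>-1\<close>. The image \<open>(e + 8m, 8d)\<close> of \<open>(1, 8)\<close> has to
  satisfy the congruence \<open>c \<equiv> -24a (mod 64)\<close> of the second lattice, that is, \<open>d \<equiv> -3e (mod 8)\<close>.
  This is impossible, since \<open>3\<close> is not \<open>\<plusminus>1\<close> modulo \<open>8\<close>.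
  The lemma \<open>no_lattice_chain_automorphism\<close> is this argument; what it needs to know about the
  lattices is supplied by linear congruences satisfied on \<open>A\<^sub>0\<close> and \<open>A\<^sub>1\<close>, each checked on generators.
\<close>

lemma additive_int_eq_mult:
  fixes F :: "int \<Rightarrow> int"
  assumes "\<And>x y. F (x + y) = F x + F y"
  shows "F x = x * F 1"
proof (induction x rule: int_induct[where k = 0])
  case base
  show ?case using assms[of 0 0] by simp
next
  case (step1 i)
  then show ?case using assms[of i 1] by (simp add: algebra_simps)
next
  case (step2 i)
  then show ?case using assms[of "i - 1" 1] by (simp add: algebra_simps)
qed

lemma additive_int_pair_eq:
  fixes F :: "int \<Rightarrow> int \<Rightarrow> int"
  assumes add: "\<And>x y x' y'. F (x + x') (y + y') = F x y + F x' y'"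
  shows "F x y = x * F 1 0 + y * F 0 1"
proof -
  have "F x 0 = x * F 1 0"
    by (rule additive_int_eq_mult) (metis add add_0)
  moreover have "F 0 y = y * F 0 1"
    by (rule additive_int_eq_mult) (metis add add_0)
  ultimately show ?thesis using add[of x 0 0 y] by simp
qed

text \<open>
  The two lattice chains enter through the images of \<open>(8, 0)\<close> under the map \<open>(H1, H2)\<close> and its
  inverse \<open>(K1, K2)\<close>, and through the image of \<open>(1, 8)\<close>. The diagonal entries of the triangular
  matrices of the two maps are inverse to each other, hence units.
\<close>

lemma no_lattice_chain_automorphism:
  fixes H1 H2 K1 K2 :: "int \<Rightarrow> int \<Rightarrow> int"
  assumes H1: "\<And>x y x' y'. H1 (x + x') (y + y') = H1 x y + H1 x' y'"
    and H2: "\<And>x y x' y'. H2 (x + x') (y + y') = H2 x y + H2 x' y'"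
    and K1: "\<And>x y x' y'. K1 (x + x') (y + y') = K1 x y + K1 x' y'"
    and K2: "\<And>x y x' y'. K2 (x + x') (y + y') = K2 x y + K2 x' y'"
    and KH: "K1 (H1 1 0) (H2 1 0) = 1"
    and HK: "H2 (K1 0 1) (K2 0 1) = 1"
    and node0: "H2 8 0 = 0" "K2 8 0 = 0"
    and node1: "64 dvd H2 1 8 + 24 * H1 1 8"
  shows False
proof -
  note lin = additive_int_pair_eq[of H1, OF H1] additive_int_pair_eq[of H2, OF H2]
    additive_int_pair_eq[of K1, OF K1] additive_int_pair_eq[of K2, OF K2]
  define e m d where "e = H1 1 0" and "m = H1 0 1" and "d = H2 0 1"
  have H2_10: "H2 1 0 = 0"
    using node0(1) lin(2)[of 8 0] by simp
  have "e * K1 1 0 = 1"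
    using KH lin(3)[of "H1 1 0" 0] by (simp add: H2_10 e_def)
  then have e: "e = 1 \<or> e = -1"
    by (metis zmult_eq_1_iff)
  have "K2 0 1 * d = 1"
    using HK lin(2)[of "K1 0 1" "K2 0 1"] by (simp add: H2_10 d_def)
  then have d: "d = 1 \<or> d = -1"
    by (metis zmult_eq_1_iff)
  have "64 dvd 8 * d + 24 * (e + 8 * m)"
    using node1 lin(1)[of 1 8] lin(2)[of 1 8] by (simp add: H2_10 e_def m_def d_def)
  then obtain j where "8 * d + 24 * (e + 8 * m) = 64 * j" ..
  then have "d + 3 * e = 8 * (j - 3 * m)" by simp
  then show False
    using e d by presburger
qed

lemma inv_Z3: "inv\<^bsub>Z3\<^esub> (a, b, c) = (- a, - b, - c)"
proof -
  interpret comm_group Z3 by (rule comm_group_Z3)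
  show ?thesis by (rule inv_equality) auto
qed

lemma subgroup_Z3_dvd: "subgroup {(a, b, c). n dvd p * a + q * b + r * c} Z3"
proof -
  interpret comm_group Z3 by (rule comm_group_Z3)
  show ?thesis
  proof (rule subgroupI)
    fix x assume "x \<in> {(a, b, c). n dvd p * a + q * b + r * c}"
    then obtain a b c where "x = (a, b, c)" "n dvd p * a + q * b + r * c" by auto
    moreover have "p * (- a) + q * (- b) + r * (- c) = - (p * a + q * b + r * c)" by simp
    ultimately show "inv\<^bsub>Z3\<^esub> x \<in> {(a, b, c). n dvd p * a + q * b + r * c}"
      by (simp only: inv_Z3 mem_Collect_eq prod.case dvd_minus_iff)
  next
    fix x y
    assume "x \<in> {(a, b, c). n dvd p * a + q * b + r * c}"
      and "y \<in> {(a, b, c). n dvd p * a + q * b + r * c}"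
    then obtain a b c a' b' c' where xy: "x = (a, b, c)" "y = (a', b', c')"
      and dvd: "n dvd p * a + q * b + r * c" "n dvd p * a' + q * b' + r * c'" by auto
    have "p * (a + a') + q * (b + b') + r * (c + c')
        = (p * a + q * b + r * c) + (p * a' + q * b' + r * c')"
      by (simp add: algebra_simps)
    then show "x \<otimes>\<^bsub>Z3\<^esub> y \<in> {(a, b, c). n dvd p * a + q * b + r * c}"
      using dvd_add[OF dvd] by (simp add: xy)
  next
    have "(0, 0, 0) \<in> {(a, b, c). n dvd p * a + q * b + r * c}" by simp
    then show "{(a, b, c). n dvd p * a + q * b + r * c} \<noteq> {}" by blast
  qed simp
qed

lemma generate_Z3_dvd:
  assumes "(x, y, z) \<in> generate Z3 B"
    and "\<And>a b c. (a, b, c) \<in> B \<Longrightarrow> n dvd p * a + q * b + r * c"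
  shows "n dvd p * x + q * y + r * z"
proof -
  interpret comm_group Z3 by (rule comm_group_Z3)
  have "generate Z3 B \<subseteq> {(a, b, c). n dvd p * a + q * b + r * c}"
    by (rule generate_subgroup_incl[OF _ subgroup_Z3_dvd]) (use assms(2) in auto)
  then show ?thesis using assms(1) by auto
qed

text \<open>Modulus \<open>0\<close> turns the congruence into the equation of the plane \<open>c = 0\<close>.\<close>

lemma A_0_third:
  assumes "(a, b, c) \<in> A 0"
  shows "c = 0"
proof -
  have gen: "(a, b, c) \<in> generate Z3 {(1, 3, 0), (3, 1, 0)}"
    using assms by (simp add: A_def)
  have "0 dvd 0 * a + 0 * b + 1 * c"
    by (rule generate_Z3_dvd[OF gen]) auto
  then show ?thesis by simp
qed

lemma A_1_dvd:
  assumes "(a, b, c) \<in> A 1"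
  shows "64 dvd 24 * a - 8 * b + c"
proof -
  have gen: "(a, b, c) \<in> generate Z3 {(1, 0, -24), (0, 1, 8), (0, 0, 64)}"
    using assms by (simp add: A_def)
  have "64 dvd 24 * a + (- 8) * b + 1 * c"
    by (rule generate_Z3_dvd[OF gen]) auto
  then show ?thesis by simp
qed

lemma A_0_mem: "(0, 8, 0) \<in> A 0" "(8, 0, 0) \<in> A 0"
proof -
  interpret subgroup "A 0" Z3 by (rule subgroup_A)
  have gen: "(1, 3, 0) \<in> A 0" "(3, 1, 0) \<in> A 0"
    by (auto simp: A_def intro: generate.incl)
  have inv: "(- a, - b, - c) \<in> A 0" if "(a, b, c) \<in> A 0" for a b c
    using m_inv_closed[OF that] by (simp add: inv_Z3)
  note add = m_closed[of "(_, _, _)" "(_, _, _)", unfolded mult_Z3]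
  show "(0, 8, 0) \<in> A 0"
    using add[OF add[OF gen(1) add[OF gen(1) gen(1)]] inv[OF gen(2)]] by simp
  show "(8, 0, 0) \<in> A 0"
    using add[OF add[OF gen(2) add[OF gen(2) gen(2)]] inv[OF gen(1)]] by simp
qed

lemma A_1_mem: "(0, 1, 8) \<in> A 1"
  by (auto simp: A_def intro: generate.incl)

lemma A_2: "A 2 = UNIV"
  by (simp add: A_def)

lemma ker_arrow_mult:
  "arrow ker_f i j = (\<lambda>x. x)" "arrow ker_g i j = (\<lambda>x. x)"
  "monoid.mult (node ker_f i) = monoid.mult Z3" "monoid.mult (node ker_g i) = monoid.mult Z3"
  by (simp_all add: kernel_diagram_def A_diagram_def subgroup_diagram_def)

theorem theorem2:
  shows "\<nexists>h. is_isomorphism T ker_f ker_g h"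
proof
  assume "\<exists>h. is_isomorphism T ker_f ker_g h"
  then obtain h k where h: "is_morphism T ker_f ker_g h" and k: "is_morphism T ker_g ker_f k"
    and kh: "\<forall>i\<in>T. \<forall>x\<in>carrier (node ker_f i). k i (h i x) = x"
    and hk: "\<forall>i\<in>T. \<forall>y\<in>carrier (node ker_g i). h i (k i y) = y"
    unfolding is_isomorphism_def by blast
  have T: "0 \<in> T" "1 \<in> T" "2 \<in> T" by (auto simp: T_def)
  have h_hom: "h i \<in> hom (node ker_f i) (node ker_g i)" if "i \<in> T" for i
    using h that by (auto simp: is_morphism_def)
  have k_hom: "k i \<in> hom (node ker_g i) (node ker_f i)" if "i \<in> T" for i
    using k that by (auto simp: is_morphism_def)

  \<comment> \<open>All arrows are inclusions, so naturality says that the node 2 components extend the others.\<close>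
  have h_node: "h 2 x \<in> A i \<inter> {(a, b, c). b = 0}"
    if "x \<in> A i" "fst x = 0" "i \<in> {0, 1, 2}" for i x
  proof -
    have i: "i \<in> T" "i \<le> 2" and x: "x \<in> carrier (node ker_f i)"
      using that by (auto simp: T_def carrier_ker_f)
    then have "h 2 x = h i x"
      using h T unfolding is_morphism_def ker_arrow_mult by blast
    then show ?thesis
      using hom_in_carrier[OF h_hom[OF i(1)] x] by (simp only: carrier_ker_g)
  qed
  have k_node: "k 2 x \<in> A i \<inter> {(a, b, c). a = 0}"
    if "x \<in> A i" "fst (snd x) = 0" "i \<in> {0, 1, 2}" for i x
  proof -
    have i: "i \<in> T" "i \<le> 2" and x: "x \<in> carrier (node ker_g i)"
      using that by (auto simp: T_def carrier_ker_g)
    then have "k 2 x = k i x"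
      using k T unfolding is_morphism_def ker_arrow_mult by blast
    then show ?thesis
      using hom_in_carrier[OF k_hom[OF i(1)] x] by (simp only: carrier_ker_f)
  qed

  define H1 H2 where "H1 b c = fst (h 2 (0, b, c))" and "H2 b c = snd (snd (h 2 (0, b, c)))" for b c
  define K1 K2 where "K1 a c = fst (snd (k 2 (a, 0, c)))" and "K2 a c = snd (snd (k 2 (a, 0, c)))"
    for a c
  have h_eq: "h 2 (0, b, c) = (H1 b c, 0, H2 b c)" for b c
    using h_node[of "(0, b, c)" 2] by (auto simp: A_2 H1_def H2_def)
  have k_eq: "k 2 (a, 0, c) = (0, K1 a c, K2 a c)" for a c
    using k_node[of "(a, 0, c)" 2] by (auto simp: A_2 K1_def K2_def)
  have h_add: "h 2 (0, b + b', c + c') = (H1 b c + H1 b' c', 0, H2 b c + H2 b' c')" for b b' c c'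
    using hom_mult[OF h_hom[OF T(3)], of "(0, b, c)" "(0, b', c')"]
    by (simp add: carrier_ker_f A_2 ker_arrow_mult h_eq)
  have k_add: "k 2 (a + a', 0, c + c') = (0, K1 a c + K1 a' c', K2 a c + K2 a' c')" for a a' c c'
    using hom_mult[OF k_hom[OF T(3)], of "(a, 0, c)" "(a', 0, c')"]
    by (simp add: carrier_ker_g A_2 ker_arrow_mult k_eq)
  show False
  proof (rule no_lattice_chain_automorphism[of H1 H2 K1 K2])
    show "H1 (x + x') (y + y') = H1 x y + H1 x' y'" "H2 (x + x') (y + y') = H2 x y + H2 x' y'"
      for x y x' y'
      using h_add[of x x' y y'] by (simp_all add: h_eq)
    show "K1 (x + x') (y + y') = K1 x y + K1 x' y'" "K2 (x + x') (y + y') = K2 x y + K2 x' y'"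
      for x y x' y'
      using k_add[of x x' y y'] by (simp_all add: k_eq)
    have "k 2 (h 2 (0, 1, 0)) = (0, 1, 0)"
      using kh T(3) by (simp add: carrier_ker_f A_2)
    then show "K1 (H1 1 0) (H2 1 0) = 1"
      by (simp add: h_eq k_eq)
    have "h 2 (k 2 (0, 0, 1)) = (0, 0, 1)"
      using hk T(3) by (simp add: carrier_ker_g A_2)
    then show "H2 (K1 0 1) (K2 0 1) = 1"
      by (simp add: h_eq k_eq)
    show "H2 8 0 = 0"
      using h_node[OF A_0_mem(1)] A_0_third by (simp add: h_eq)
    show "K2 8 0 = 0"
      using k_node[OF A_0_mem(2)] A_0_third by (simp add: k_eq)
    show "64 dvd H2 1 8 + 24 * H1 1 8"
      using h_node[OF A_1_mem] A_1_dvd[of "H1 1 8" 0 "H2 1 8"] by (simp add: h_eq add.commute)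
  qed
qed

end
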